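(* Let $\alpha^+,\lambda^+,\alpha^-,\lambda^->0$ and let $f$ be the density of the bilateral Gamma distribution with parameters $(\alpha^+,\lambda^+;\alpha^-,\lambda^-)$. There exists a point $x_0\in\mathbb{R}$ such that $f$ is strictly increasing on $(-\infty,x_0)$ and strictly decreasing on $(x_0,\infty)$.
   Context: For $\alpha,\lambda>0$, $\Gamma(\alpha,\lambda)$ denotes the Gamma distribution with density $\frac{\lambda^\alpha}{\Gamma(\alpha)}x^{\alpha-1}e^{-\lambda x}$ on $(0,\infty)$. The bilateral Gamma distribution with parameters $(\alpha^+,\lambda^+;\alpha^-,\lambda^-)$, all $>0$, is the distribution of $X-Y$ where $X\sim\Gamma(\alpha^+,\lambda^+)$ and $Y\sim\Gamma(\alpha^-,\lambda^-)$ are independent. Its density $f(x)=f(x;\alpha^+,\lambda^+,\alpha^-,\lambda^-)$ is given for $x>0$ by $$f(x)=\frac{(\lambda^+)^{\alpha^+}(\lambda^-)^{\alpha^-}}{(\lambda^++\lambda^-)^{\alpha^-}\Gamma(\alpha^+)\Gamma(\alpha^-)}e^{-\lambda^+x}\int_0^\infty v^{\alpha^--1}\Big(x+\frac{v}{\lambda^++\lambda^-}\Big)^{\alpha^+-1}e^{-v}\,dv,$$ and for $x<0$ by $f(x;\alpha^+,\lambda^+,\alpha^-,\lambda^-)=f(-x;\alpha^-,\lambda^-,\alpha^+,\lambda^+)$. The value $f(0)$ is taken to be the continuous extension whenever one exists (otherwise it is arbitrary). *)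

theory Defs
  imports "HOL-Probability.Probability" "HOL-Real_Asymp.Real_Asymp"
begin

definition gamma_density :: "real \<Rightarrow> real \<Rightarrow> real \<Rightarrow> real" where
  "gamma_density \<alpha> \<beta> x =
     (if x > 0 then \<beta> powr \<alpha> / Gamma \<alpha> * x powr (\<alpha> - 1) * exp (- \<beta> * x) else 0)"

definition gamma_distribution :: "real \<Rightarrow> real \<Rightarrow> real measure" where
  "gamma_distribution \<alpha> \<beta> = density lborel (\<lambda>x. ennreal (gamma_density \<alpha> \<beta> x))"

text \<open>The law of \<open>X - Y\<close> for independent \<open>X\<close> and \<open>Y\<close>; the parameters are listed in the order
  \<open>\<alpha>\<^sup>+, \<lambda>\<^sup>+, \<alpha>\<^sup>-, \<lambda>\<^sup>-\<close>.\<close>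

definition bilateral_gamma_distribution :: "real \<Rightarrow> real \<Rightarrow> real \<Rightarrow> real \<Rightarrow> real measure" where
  "bilateral_gamma_distribution ap lp am lm =
     distr (gamma_distribution ap lp \<Otimes>\<^sub>M gamma_distribution am lm) borel (\<lambda>(x, y). x - y)"

text \<open>The explicit formula for the density; it is meaningful for \<open>x > 0\<close> only.\<close>

definition bilateral_gamma_formula :: "real \<Rightarrow> real \<Rightarrow> real \<Rightarrow> real \<Rightarrow> real \<Rightarrow> real" where
  "bilateral_gamma_formula ap lp am lm x =
     lp powr ap * lm powr am / ((lp + lm) powr am * Gamma ap * Gamma am) * exp (- lp * x) *
     (LBINT v:{0<..}. v powr (am - 1) * (x + v / (lp + lm)) powr (ap - 1) * exp (- v))"

text \<open>The formulas leave the value at \<open>0\<close> open: it is the continuous extension when \<open>f\<close> has a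
  finite limit at \<open>0\<close>, and unconstrained otherwise. Hence a predicate on \<open>f\<close> rather than a
  function. Lemma \<open>density_bilateral_gamma\<close> below shows that every such \<open>f\<close> is a density of the
  bilateral Gamma distribution.\<close>

definition is_bilateral_gamma_density ::
    "real \<Rightarrow> real \<Rightarrow> real \<Rightarrow> real \<Rightarrow> (real \<Rightarrow> real) \<Rightarrow> bool" where
  "is_bilateral_gamma_density ap lp am lm f \<longleftrightarrow>
     (\<forall>x>0. f x = bilateral_gamma_formula ap lp am lm x) \<and>
     (\<forall>x<0. f x = bilateral_gamma_formula am lm ap lp (- x)) \<and>
     (\<forall>l. (f \<longlongrightarrow> l) (at 0) \<longrightarrow> f 0 = l)"

lemma is_bilateral_gamma_density_exists: "\<exists>f. is_bilateral_gamma_density ap lp am lm f"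
proof -
  define g where "g = (\<lambda>x. if x > 0 then bilateral_gamma_formula ap lp am lm x
                            else bilateral_gamma_formula am lm ap lp (- x))"
  define f where "f = g(0 := Lim (at 0) g)"
  have *: "(f \<longlongrightarrow> l) (at 0) \<longleftrightarrow> (g \<longlongrightarrow> l) (at 0)" for l
    unfolding f_def by (intro filterlim_cong) (auto simp: eventually_at_filter)
  have "f 0 = l" if "(f \<longlongrightarrow> l) (at 0)" for l
    using that tendsto_Lim[of "at 0" g l] unfolding * by (simp add: f_def)
  thus ?thesis
    unfolding is_bilateral_gamma_density_def by (intro exI[of _ f]) (auto simp: f_def g_def)
qed

lemma gamma_density_nonneg: "\<alpha> > 0 \<Longrightarrow> gamma_density \<alpha> \<beta> x \<ge> 0"
  by (simp add: gamma_density_def Gamma_real_pos less_imp_le)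

lemma gamma_density_measurable [measurable]: "gamma_density \<alpha> \<beta> \<in> borel_measurable borel"
  unfolding gamma_density_def[abs_def] by measurable

lemma nn_integral_gamma_density:
  assumes "\<alpha> > 0" "\<beta> > 0"
  shows "(\<integral>\<^sup>+x. ennreal (gamma_density \<alpha> \<beta> x) \<partial>lborel) = 1"
proof -
  note G = Gamma_real_pos[OF assms(1)]
  have "(\<integral>\<^sup>+x. ennreal (gamma_density \<alpha> \<beta> x) \<partial>lborel) =
        ennreal \<bar>1 / \<beta>\<bar> * (\<integral>\<^sup>+x. ennreal (gamma_density \<alpha> \<beta> (0 + 1 / \<beta> * x)) \<partial>lborel)"
    using assms by (intro nn_integral_real_affine) auto
  also have "\<dots> = (\<integral>\<^sup>+x. ennreal (1 / \<beta>) * ennreal (gamma_density \<alpha> \<beta> (0 + 1 / \<beta> * x)) \<partial>lborel)"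
    using assms by (simp add: nn_integral_cmult)
  also have "\<dots> = (\<integral>\<^sup>+x. ennreal (1 / Gamma \<alpha>) *
                     ennreal (indicator {0..} x * x powr (\<alpha> - 1) / exp x) \<partial>lborel)"
  proof (intro nn_integral_cong)
    fix x :: real
    show "ennreal (1 / \<beta>) * ennreal (gamma_density \<alpha> \<beta> (0 + 1 / \<beta> * x)) =
          ennreal (1 / Gamma \<alpha>) * ennreal (indicator {0..} x * x powr (\<alpha> - 1) / exp x)"
    proof (cases "x > 0")
      case True
      have "\<beta> powr \<alpha> = \<beta> powr (\<alpha> - 1) * \<beta>"
        using assms by (simp add: powr_diff)
      hence "1 / \<beta> * gamma_density \<alpha> \<beta> (0 + 1 / \<beta> * x) =
             1 / Gamma \<alpha> * (x powr (\<alpha> - 1) / exp x)"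
        using True assms G by (simp add: gamma_density_def powr_divide exp_minus field_simps)
      thus ?thesis using True assms G
        by (simp add: ennreal_mult'[symmetric] gamma_density_nonneg)
    next
      case False
      thus ?thesis using assms by (cases "x = 0") (auto simp: gamma_density_def zero_less_divide_iff)
    qed
  qed
  also have "\<dots> = ennreal (1 / Gamma \<alpha>) * ennreal (Gamma \<alpha>)"
    using assms G by (simp add: nn_integral_cmult Gamma_conv_nn_integral_real)
  also have "\<dots> = 1"
    using G by (simp add: ennreal_mult'[symmetric])
  finally show ?thesis .
qed

lemma prob_space_gamma_distribution:
  assumes "\<alpha> > 0" "\<beta> > 0"
  shows "prob_space (gamma_distribution \<alpha> \<beta>)"
  unfolding gamma_distribution_def
  by (rule prob_spaceI) (simp add: emeasure_density nn_integral_gamma_density assms)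

lemma gamma_density_bounded:
  assumes "\<alpha> > 0" "\<beta> > 0" "z > 0"
  obtains B where "B > 0" "\<And>t. t \<ge> z \<Longrightarrow> gamma_density \<alpha> \<beta> t \<le> B"
proof -
  have "(gamma_density \<alpha> \<beta> \<longlongrightarrow> 0) at_top"
  proof (rule Lim_transform_eventually)
    show "((\<lambda>t. \<beta> powr \<alpha> / Gamma \<alpha> * (t powr (\<alpha> - 1) * exp (- \<beta> * t))) \<longlongrightarrow> 0) at_top"
      by (rule tendsto_mult_right_zero) (use assms in real_asymp)
    show "\<forall>\<^sub>F t in at_top. \<beta> powr \<alpha> / Gamma \<alpha> * (t powr (\<alpha> - 1) * exp (- \<beta> * t)) =
            gamma_density \<alpha> \<beta> t"
      using eventually_gt_at_top[of 0] by eventually_elim (simp add: gamma_density_def)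
  qed
  hence "\<forall>\<^sub>F t in at_top. gamma_density \<alpha> \<beta> t < 1"
    by (rule order_tendstoD) auto
  then obtain T where T: "\<And>t. t \<ge> T \<Longrightarrow> gamma_density \<alpha> \<beta> t < 1"
    by (auto simp: eventually_at_top_linorder)
  have "continuous_on {z..T} (\<lambda>t. \<beta> powr \<alpha> / Gamma \<alpha> * t powr (\<alpha> - 1) * exp (- \<beta> * t))"
    using assms by (intro continuous_intros) auto
  hence "continuous_on {z..T} (gamma_density \<alpha> \<beta>)"
    using assms by (subst continuous_on_cong[OF refl]) (auto simp: gamma_density_def)
  hence "bounded (gamma_density \<alpha> \<beta> ` {z..T})"
    by (intro compact_imp_bounded compact_continuous_image) auto
  then obtain b where b: "\<And>t. t \<in> {z..T} \<Longrightarrow> norm (gamma_density \<alpha> \<beta> t) \<le> b"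
    unfolding bounded_iff by blast
  show ?thesis
  proof (rule that[of "max b 1"])
    fix t assume "t \<ge> z"
    thus "gamma_density \<alpha> \<beta> t \<le> max b 1"
      using T[of t] b[of t] by (cases "t \<ge> T") auto
  qed auto
qed

lemma nn_integral_bilateral_gamma_formula:
  assumes pos: "ap > 0" "lp > 0" "am > 0" "lm > 0" and z: "z > 0"
  shows "(\<integral>\<^sup>+y. ennreal (gamma_density ap lp (z + y)) * ennreal (gamma_density am lm y) \<partial>lborel) =
           ennreal (bilateral_gamma_formula ap lp am lm z)"
proof -
  define c where "c = 1 / (lp + lm)"
  define K where "K = lp powr ap * lm powr am / ((lp + lm) powr am * Gamma ap * Gamma am) * exp (- lp * z)"
  define h where "h = (\<lambda>v. indicator {0<..} v *
     (v powr (am - 1) * (z + v / (lp + lm)) powr (ap - 1) * exp (- v)) :: real)"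
  note G = Gamma_real_pos[OF pos(1)] Gamma_real_pos[OF pos(3)]
  have c: "c > 0" and K: "K > 0"
    using pos G by (auto simp: c_def K_def)
  have h: "h v \<ge> 0" for v by (auto simp: h_def indicator_def)
  have [measurable]: "h \<in> borel_measurable borel" unfolding h_def by measurable
  let ?I = "\<integral>\<^sup>+y. ennreal (gamma_density ap lp (z + y)) * ennreal (gamma_density am lm y) \<partial>lborel"
  have "?I = ennreal \<bar>c\<bar> * (\<integral>\<^sup>+v. ennreal (gamma_density ap lp (z + (0 + c * v))) *
                                 ennreal (gamma_density am lm (0 + c * v)) \<partial>lborel)"
    using c by (intro nn_integral_real_affine) auto
  also have "\<dots> = (\<integral>\<^sup>+v. ennreal c * (ennreal (gamma_density ap lp (z + c * v)) *
                                 ennreal (gamma_density am lm (c * v))) \<partial>lborel)"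
    using c by (simp add: nn_integral_cmult)
  also have "\<dots> = (\<integral>\<^sup>+v. ennreal K * ennreal (h v) \<partial>lborel)"
  proof (intro nn_integral_cong)
    fix v :: real
    show "ennreal c * (ennreal (gamma_density ap lp (z + c * v)) * ennreal (gamma_density am lm (c * v))) =
          ennreal K * ennreal (h v)"
    proof (cases "v > 0")
      case True
      have v: "c * v > 0" "z + c * v > 0"
        using True c z by (auto intro: add_pos_pos)
      have e: "exp (- lp * (z + c * v)) * exp (- lm * (c * v)) = exp (- lp * z) * exp (- v)"
      proof -
        have "- lp * (z + c * v) + - lm * (c * v) = - lp * z + - ((lp + lm) * c * v)"
          by (simp add: algebra_simps)
        also have "(lp + lm) * c = 1" using pos by (simp add: c_def)
        finally show ?thesis by (simp add: exp_add[symmetric])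
      qed
      have p: "c * (c * v) powr (am - 1) = v powr (am - 1) / (lp + lm) powr am"
      proof -
        have "c * (c * v) powr (am - 1) = (c * c powr (am - 1)) * v powr (am - 1)"
          using c True by (simp add: powr_mult)
        also have "c * c powr (am - 1) = c powr am"
          using c by (simp add: powr_diff)
        also have "c powr am = 1 / (lp + lm) powr am"
          using pos by (simp add: c_def powr_divide)
        finally show ?thesis by simp
      qed
      have "c * (gamma_density ap lp (z + c * v) * gamma_density am lm (c * v)) =
            lp powr ap * lm powr am / (Gamma ap * Gamma am) * (z + c * v) powr (ap - 1) *
            (c * (c * v) powr (am - 1)) * (exp (- lp * (z + c * v)) * exp (- lm * (c * v)))"
        using v by (simp add: gamma_density_def)
      also have "\<dots> = K * h v"
        unfolding e p using True by (simp add: K_def h_def c_def mult_ac)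
      finally show ?thesis
        using c K h pos by (simp add: ennreal_mult'[symmetric] gamma_density_nonneg)
    next
      case False
      hence "\<not> c * v > 0" using c by (simp add: zero_less_mult_iff)
      thus ?thesis using False by (simp add: gamma_density_def h_def)
    qed
  qed
  also have "\<dots> = ennreal K * (\<integral>\<^sup>+v. ennreal (h v) \<partial>lborel)"
    by (simp add: nn_integral_cmult)
  finally have eq: "?I = ennreal K * (\<integral>\<^sup>+v. ennreal (h v) \<partial>lborel)" .

  obtain B where B: "B > 0" "\<And>t. t \<ge> z \<Longrightarrow> gamma_density ap lp t \<le> B"
    using gamma_density_bounded[of ap lp z] pos z by metis
  have "?I \<le> (\<integral>\<^sup>+y. ennreal B * ennreal (gamma_density am lm y) \<partial>lborel)"
  proof (intro nn_integral_mono)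
    fix y :: real
    show "ennreal (gamma_density ap lp (z + y)) * ennreal (gamma_density am lm y) \<le>
          ennreal B * ennreal (gamma_density am lm y)"
    proof (cases "y > 0")
      case True
      thus ?thesis using B(2)[of "z + y"] by (intro mult_right_mono ennreal_leI) auto
    qed (simp add: gamma_density_def)
  qed
  also have "\<dots> = ennreal B"
    using pos by (simp add: nn_integral_cmult nn_integral_gamma_density)
  finally have "?I < \<infinity>" using order_le_less_trans[of ?I "ennreal B" \<infinity>] by simp
  hence fin: "(\<integral>\<^sup>+v. ennreal (h v) \<partial>lborel) < \<infinity>"
    using K unfolding eq by (auto simp: ennreal_mult_less_top ennreal_eq_0_iff)
  have "integrable lborel h"
    using fin h by (intro integrableI_nonneg) auto
  hence "(\<integral>\<^sup>+v. ennreal (h v) \<partial>lborel) = ennreal (integral\<^sup>L lborel h)"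
    using h by (intro nn_integral_eq_integral) auto
  hence "?I = ennreal (K * integral\<^sup>L lborel h)"
    using eq K by (simp add: ennreal_mult')
  thus ?thesis
    by (simp add: bilateral_gamma_formula_def K_def h_def set_lebesgue_integral_def)
qed

lemma density_bilateral_gamma:
  assumes pos: "ap > 0" "lp > 0" "am > 0" "lm > 0"
    and f: "is_bilateral_gamma_density ap lp am lm f"
  shows "bilateral_gamma_distribution ap lp am lm = density lborel (\<lambda>x. ennreal (f x))"
proof -
  define u where "u = (\<lambda>x. ennreal (gamma_density ap lp x))"
  define w where "w = (\<lambda>x. ennreal (gamma_density am lm x))"
  define g where "g = (\<lambda>z. \<integral>\<^sup>+y. u (z + y) * w y \<partial>lborel)"
  have [measurable]: "u \<in> borel_measurable borel" "w \<in> borel_measurable borel"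
    unfolding u_def w_def by measurable
  have [measurable]: "g \<in> borel_measurable borel"
    unfolding g_def by measurable
  interpret U: prob_space "gamma_distribution ap lp"
    using pos by (intro prob_space_gamma_distribution)
  interpret W: prob_space "gamma_distribution am lm"
    using pos by (intro prob_space_gamma_distribution)
  interpret P: pair_sigma_finite "gamma_distribution ap lp" "gamma_distribution am lm" ..
  have fg: "ennreal (f z) = g z" if "z \<noteq> 0" for z
  proof (cases "z > 0")
    case True
    thus ?thesis
      using f nn_integral_bilateral_gamma_formula[OF pos True]
      by (simp add: g_def u_def w_def is_bilateral_gamma_density_def)
  next
    case False
    hence z: "- z > 0" using that by simp
    have "g z = ennreal \<bar>1\<bar> * (\<integral>\<^sup>+y. u (z + (- z + 1 * y)) * w (- z + 1 * y) \<partial>lborel)"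
      unfolding g_def by (intro nn_integral_real_affine) auto
    also have "\<dots> = (\<integral>\<^sup>+y. w (- z + y) * u y \<partial>lborel)"
      by (simp add: mult.commute)
    also have "\<dots> = ennreal (f z)"
      using f z nn_integral_bilateral_gamma_formula[OF pos(3,4,1,2) z]
      by (simp add: u_def w_def is_bilateral_gamma_density_def)
    finally show ?thesis ..
  qed
  have AE: "AE z in lborel. ennreal (f z) = g z"
    using AE_lborel_singleton[of 0] by eventually_elim (rule fg)
  have [measurable]: "(\<lambda>x. ennreal (f x)) \<in> borel_measurable borel"
  proof -
    have "(\<lambda>x. ennreal (f x)) = (\<lambda>x. if x = 0 then ennreal (f 0) else g x)"
      using fg by auto
    thus ?thesis by simp
  qed
  show ?thesis
  proof (rule measure_eqI)
    show "sets (bilateral_gamma_distribution ap lp am lm) = sets (density lborel (\<lambda>x. ennreal (f x)))"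
      by (simp add: bilateral_gamma_distribution_def)
    fix A assume "A \<in> sets (bilateral_gamma_distribution ap lp am lm)"
    hence [measurable]: "A \<in> sets borel" by (simp add: bilateral_gamma_distribution_def)
    have s: "sets (gamma_distribution a b) = sets borel" for a b
      by (simp add: gamma_distribution_def)
    have [measurable_cong]: "sets (gamma_distribution ap lp \<Otimes>\<^sub>M gamma_distribution am lm) =
        sets (borel \<Otimes>\<^sub>M borel)"
      by (intro sets_pair_measure_cong s)
    have "emeasure (bilateral_gamma_distribution ap lp am lm) A =
          (\<integral>\<^sup>+q. indicator A q \<partial>bilateral_gamma_distribution ap lp am lm)"
      by (simp add: bilateral_gamma_distribution_def)
    also have "\<dots> = (\<integral>\<^sup>+q. indicator A (fst q - snd q)
                     \<partial>(gamma_distribution ap lp \<Otimes>\<^sub>M gamma_distribution am lm))"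
      unfolding bilateral_gamma_distribution_def case_prod_unfold
      by (subst nn_integral_distr) auto
    also have "\<dots> = (\<integral>\<^sup>+y. \<integral>\<^sup>+x. indicator A (x - y) \<partial>gamma_distribution ap lp \<partial>gamma_distribution am lm)"
      by (subst P.nn_integral_snd[symmetric]) auto
    also have "\<dots> = (\<integral>\<^sup>+y. w y * (\<integral>\<^sup>+x. u x * indicator A (x - y) \<partial>lborel) \<partial>lborel)"
      by (simp add: gamma_distribution_def nn_integral_density u_def w_def)
    also have "\<dots> = (\<integral>\<^sup>+y. w y * (\<integral>\<^sup>+z. u (y + z) * indicator A z \<partial>lborel) \<partial>lborel)"
    proof (rule nn_integral_cong, rule arg_cong2[OF refl, where f = "(*)"])
      fix y :: real
      have "(\<integral>\<^sup>+x. u x * indicator A (x - y) \<partial>lborel) =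
            ennreal \<bar>1\<bar> * (\<integral>\<^sup>+z. u (y + 1 * z) * indicator A (y + 1 * z - y) \<partial>lborel)"
        by (intro nn_integral_real_affine) auto
      thus "(\<integral>\<^sup>+x. u x * indicator A (x - y) \<partial>lborel) = (\<integral>\<^sup>+z. u (y + z) * indicator A z \<partial>lborel)"
        by simp
    qed
    also have "\<dots> = (\<integral>\<^sup>+y. \<integral>\<^sup>+z. w y * (u (y + z) * indicator A z) \<partial>lborel \<partial>lborel)"
      by (simp add: nn_integral_cmult)
    also have "\<dots> = (\<integral>\<^sup>+z. \<integral>\<^sup>+y. w y * (u (y + z) * indicator A z) \<partial>lborel \<partial>lborel)"
      by (rule lborel_pair.Fubini') measurable
    also have "\<dots> = (\<integral>\<^sup>+z. \<integral>\<^sup>+y. (u (z + y) * w y) * indicator A z \<partial>lborel \<partial>lborel)"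
      by (simp add: mult_ac add.commute)
    also have "\<dots> = (\<integral>\<^sup>+z. g z * indicator A z \<partial>lborel)"
      unfolding g_def by (intro nn_integral_cong nn_integral_multc) measurable
    also have "\<dots> = (\<integral>\<^sup>+z. ennreal (f z) * indicator A z \<partial>lborel)"
      using AE by (intro nn_integral_cong_AE) auto
    also have "\<dots> = emeasure (density lborel (\<lambda>x. ennreal (f x))) A"
      by (simp add: emeasure_density)
    finally show "emeasure (bilateral_gamma_distribution ap lp am lm) A =
                  emeasure (density lborel (\<lambda>x. ennreal (f x))) A" .
  qed
qed

end

theory Submission
  imports Defs
begin

text \<open>Away from \<open>0\<close>, \<open>f x\<close> is the integral of \<open>G (x + y) * H y\<close> over \<open>y\<close>, where \<open>G\<close> and \<open>H\<close> are the two
  Gamma densities. If both shape parameters are at most \<open>1\<close>, then \<open>G\<close> and \<open>H\<close> decrease on the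
  positive half-line and \<open>x\<^sub>0 = 0\<close>. Otherwise, by reflection, the shape of \<open>G\<close> exceeds \<open>1\<close>, so \<open>G\<close> is
  continuous and log-concave. Since \<open>H (u - t) - H u\<close> changes sign once, variation diminishing gives
  that \<open>f (x + t) \<le> f x\<close> implies \<open>f (x + t + t) < f (x + t)\<close>. A continuous function with this
  property has no interior local minimum, hence is strictly quasiconcave; as \<open>f\<close> is positive and
  tends to \<open>0\<close> at both ends, it attains its maximum, at \<open>x\<^sub>0\<close>.\<close>

section \<open>The density as a convolution integral, and its behaviour under reflection\<close>

lemma integral_pos_ray:
  fixes g :: "real \<Rightarrow> real"
  assumes "integrable lborel g" and "\<And>u. 0 \<le> g u" and "\<And>u. c < u \<Longrightarrow> 0 < g u"
  shows "0 < (\<integral>u. g u \<partial>lborel)"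
proof (rule ccontr)
  assume "\<not> ?thesis"
  moreover have "0 \<le> (\<integral>u. g u \<partial>lborel)"
    using assms(2) by simp
  ultimately have "(\<integral>u. g u \<partial>lborel) = 0"
    by simp
  hence "AE u in lborel. g u = 0"
    using assms by (subst (asm) integral_nonneg_eq_0_iff_AE) auto
  \<comment> \<open>Almost everywhere vanishing would make a unit interval inside the ray a null
    set.\<close>
  hence "AE u in lborel. u \<notin> {c<..<c + 1}"
    by eventually_elim (use assms(3) in force)
  hence "emeasure lborel {c<..<c + 1} = 0"
    by (subst (asm) AE_iff_measurable[where N = "{c<..<c + 1}"]) auto
  thus False
    by simp
qed

lemma bilateral_gamma_formula_nonneg:
  assumes "ap > 0" "am > 0"
  shows "0 \<le> bilateral_gamma_formula ap lp am lm x"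
  unfolding bilateral_gamma_formula_def set_lebesgue_integral_def
  using assms by (intro mult_nonneg_nonneg divide_nonneg_nonneg integral_nonneg_AE AE_I2)
    (auto simp: Gamma_real_pos less_imp_le)

lemma has_bochner_integral_bilateral_gamma_formula:
  assumes "ap > 0" "lp > 0" "am > 0" "lm > 0" "z > 0"
  shows "has_bochner_integral lborel (\<lambda>y. gamma_density ap lp (z + y) * gamma_density am lm y)
           (bilateral_gamma_formula ap lp am lm z)"
  using assms
  by (intro has_bochner_integral_nn_integral)
    (auto simp: bilateral_gamma_formula_nonneg gamma_density_nonneg ennreal_mult'
       nn_integral_bilateral_gamma_formula)

lemma has_bochner_integral_bilateral_gamma_density:
  assumes "ap > 0" "lp > 0" "am > 0" "lm > 0" and f: "is_bilateral_gamma_density ap lp am lm f"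
    and "z \<noteq> 0"
  shows "has_bochner_integral lborel (\<lambda>y. gamma_density ap lp (z + y) * gamma_density am lm y) (f z)"
proof (cases "z > 0")
  case True
  with assms show ?thesis
    using has_bochner_integral_bilateral_gamma_formula[of ap lp am lm z]
    by (simp add: is_bilateral_gamma_density_def)
next
  case False
  hence z: "- z > 0"
    using assms by simp
  let ?g = "\<lambda>y. gamma_density am lm (- z + y) * gamma_density ap lp y"
  have "has_bochner_integral lborel ?g (f z)"
    using has_bochner_integral_bilateral_gamma_formula[of am lm ap lp "- z"] z assms
    by (simp add: is_bilateral_gamma_density_def)
  thus ?thesis
    \<comment> \<open>Replacing \<open>y\<close> by \<open>z + y\<close> turns the formula with
      exchanged parameters into the integrand for positive \<open>z\<close>, so one integral serves
      both half-lines.\<close>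
    using lborel_has_bochner_integral_real_affine_iff[of 1 ?g "f z" z] by (simp add: mult.commute)
qed

lemma is_bilateral_gamma_density_reflect:
  assumes "is_bilateral_gamma_density ap lp am lm f"
  shows "is_bilateral_gamma_density am lm ap lp (\<lambda>x. f (- x))"
proof -
  have "f 0 = l" if "((\<lambda>x. f (- x)) \<longlongrightarrow> l) (at 0)" for l
  proof -
    have "(f \<longlongrightarrow> l) (filtermap uminus (at 0))"
      using that by (simp add: filterlim_filtermap)
    hence "(f \<longlongrightarrow> l) (at 0)"
      by (simp add: filtermap_at_minus)
    thus ?thesis
      using assms by (simp add: is_bilateral_gamma_density_def)
  qed
  thus ?thesis
    using assms by (simp add: is_bilateral_gamma_density_def)
qed

section \<open>Gamma densities: monotonicity, log-concavity, sign change, regularity\<close>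

lemma gamma_density_pos: "\<alpha> > 0 \<Longrightarrow> \<beta> > 0 \<Longrightarrow> x > 0 \<Longrightarrow> gamma_density \<alpha> \<beta> x > 0"
  by (simp add: gamma_density_def Gamma_real_pos)

lemma integrable_gamma_density:
  assumes "\<alpha> > 0" "\<beta> > 0"
  shows "integrable lborel (gamma_density \<alpha> \<beta>)"
  using assms by (intro integrableI_nonneg) (auto simp: gamma_density_nonneg nn_integral_gamma_density)

lemma gamma_density_decreasing:
  assumes "0 < \<alpha>" "\<alpha> \<le> 1" "\<beta> > 0" "0 < x" "x < y"
  shows "gamma_density \<alpha> \<beta> y < gamma_density \<alpha> \<beta> x"
proof -
  have "y powr (\<alpha> - 1) \<le> x powr (\<alpha> - 1)"
    using assms by (intro powr_mono2') auto
  moreover have "exp (- \<beta> * y) < exp (- \<beta> * x)"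
    using assms by simp
  ultimately have "y powr (\<alpha> - 1) * exp (- \<beta> * y) < x powr (\<alpha> - 1) * exp (- \<beta> * x)"
    using assms by (intro mult_le_less_imp_less) auto
  thus ?thesis
    using assms by (simp add: gamma_density_def Gamma_real_pos mult.assoc divide_strict_right_mono)
qed

text \<open>The arguments on the two sides have the same sum, so the exponential factors agree and
  only \<open>(q + t) * p < (p + t) * q\<close> is left. For \<open>p\<close> at most 0 the left
  side vanishes.\<close>

lemma gamma_density_log_concave:
  assumes "1 < \<alpha>" "\<beta> > 0" "p < q" "t > 0"
  shows "gamma_density \<alpha> \<beta> (q + t) * gamma_density \<alpha> \<beta> p
           \<le> gamma_density \<alpha> \<beta> (p + t) * gamma_density \<alpha> \<beta> q" (is "?L \<le> ?R")
    and "0 < p \<Longrightarrow> gamma_density \<alpha> \<beta> (q + t) * gamma_density \<alpha> \<beta> p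
           < gamma_density \<alpha> \<beta> (p + t) * gamma_density \<alpha> \<beta> q"
proof -
  show *: "?L < ?R" if "0 < p"
  proof -
    define C where "C = (\<beta> powr \<alpha> / Gamma \<alpha>)\<^sup>2 * exp (- \<beta> * (p + q + t))"
    have "Gamma \<alpha> > 0"
      using assms by (simp add: Gamma_real_pos)
    hence C: "C > 0"
      using assms by (auto simp: C_def intro!: mult_pos_pos zero_less_power divide_pos_pos)
    have eq: "gamma_density \<alpha> \<beta> u * gamma_density \<alpha> \<beta> v = C * (u * v) powr (\<alpha> - 1)"
      if "0 < u" "0 < v" "u + v = p + q + t" for u v
    proof -
      have "exp (- \<beta> * u) * exp (- \<beta> * v) = exp (- \<beta> * (p + q + t))"
        unfolding that(3)[symmetric] exp_add[symmetric] by (simp add: algebra_simps)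
      thus ?thesis
        using that(1,2) by (simp add: gamma_density_def C_def powr_mult power2_eq_square)
    qed
    have "p * t < q * t"
      using assms by simp
    hence "((q + t) * p) powr (\<alpha> - 1) < ((p + t) * q) powr (\<alpha> - 1)"
      using assms that by (intro powr_less_mono2) (auto simp: algebra_simps)
    thus ?thesis
      using assms that C by (simp add: eq)
  qed
  show "?L \<le> ?R"
  proof (cases "0 < p")
    case False
    hence "gamma_density \<alpha> \<beta> p = 0"
      by (simp add: gamma_density_def)
    thus ?thesis
      using assms by (simp add: gamma_density_nonneg)
  qed (use * in simp)
qed

text \<open>Up to \<open>t\<close> the shifted density vanishes. If the shape is at most 1,
  monotonicity puts the crossing at \<open>t\<close>; otherwise, beyond \<open>t\<close>, the
  comparison reduces to that of the linear functions \<open>u - t\<close> and \<open>q * u\<close>,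
  which cross once.\<close>

lemma gamma_density_shift_sign_change:
  assumes "\<alpha> > 0" "\<beta> > 0" "t > 0"
  obtains c where "\<And>u. u < c \<Longrightarrow> gamma_density \<alpha> \<beta> (u - t) \<le> gamma_density \<alpha> \<beta> u"
    and "\<And>u. c < u \<Longrightarrow> gamma_density \<alpha> \<beta> u < gamma_density \<alpha> \<beta> (u - t)"
proof -
  have left: "gamma_density \<alpha> \<beta> (u - t) \<le> gamma_density \<alpha> \<beta> u" if "u \<le> t" for u
    using that assms gamma_density_nonneg[of \<alpha> \<beta> u] by (simp add: gamma_density_def)
  show ?thesis
  proof (cases "\<alpha> \<le> 1")
    case True
    show ?thesis
      by (rule that[of t]) (use assms True left gamma_density_decreasing in auto)
  next
    case False
    \<comment> \<open>This \<open>q\<close> absorbs the factor \<open>exp (- \<beta> * t)\<close>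
      into the power.\<close>
    define q where "q = exp (- \<beta> * t / (\<alpha> - 1))"
    have q: "0 < q" "q < 1"
      using assms False by (auto simp: q_def)
    have qp: "q powr (\<alpha> - 1) = exp (- \<beta> * t)"
      using False by (simp add: q_def powr_def)
    define K where "K u = \<beta> powr \<alpha> / Gamma \<alpha> * exp (- \<beta> * (u - t))" for u
    have K: "K u > 0" for u
      using assms by (simp add: K_def Gamma_real_pos)
    have H: "gamma_density \<alpha> \<beta> (u - t) = K u * (u - t) powr (\<alpha> - 1)"
            "gamma_density \<alpha> \<beta> u = K u * (q * u) powr (\<alpha> - 1)" if "t < u" for u
    proof -
      have "exp (- \<beta> * u) = exp (- \<beta> * (u - t)) * exp (- \<beta> * t)"
        unfolding exp_add[symmetric] by (simp add: algebra_simps)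
      thus "gamma_density \<alpha> \<beta> u = K u * (q * u) powr (\<alpha> - 1)"
        using that assms q by (simp add: gamma_density_def K_def powr_mult qp)
    qed (use that assms in \<open>simp add: gamma_density_def K_def\<close>)
    show ?thesis
    proof (rule that[of "t / (1 - q)"])
      fix u assume "u < t / (1 - q)"
      hence *: "u - t < q * u"
        using q by (simp add: field_simps)
      show "gamma_density \<alpha> \<beta> (u - t) \<le> gamma_density \<alpha> \<beta> u"
      proof (cases "u \<le> t")
        case False
        thus ?thesis
          using * K[of u] \<open>\<not> \<alpha> \<le> 1\<close> by (simp add: H powr_mono2)
      qed (rule left)
    next
      fix u assume u: "t / (1 - q) < u"
      hence *: "q * u < u - t"
        using q by (simp add: field_simps)
      have "t \<le> t / (1 - q)"
        using q assms by (simp add: field_simps)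
      with u have "t < u"
        by simp
      moreover from this have "0 \<le> q * u"
        using q assms by simp
      ultimately show "gamma_density \<alpha> \<beta> u < gamma_density \<alpha> \<beta> (u - t)"
        using * K[of u] False by (simp add: H powr_less_mono2)
    qed
  qed
qed

lemma gamma_density_tendsto_at_top:
  assumes "\<beta> > 0"
  shows "(gamma_density \<alpha> \<beta> \<longlongrightarrow> 0) at_top"
proof (rule Lim_transform_eventually)
  show "((\<lambda>t. \<beta> powr \<alpha> / Gamma \<alpha> * (t powr (\<alpha> - 1) * exp (- \<beta> * t))) \<longlongrightarrow> 0) at_top"
    by (rule tendsto_mult_right_zero) (use assms in real_asymp)
  show "\<forall>\<^sub>F t in at_top. \<beta> powr \<alpha> / Gamma \<alpha> * (t powr (\<alpha> - 1) * exp (- \<beta> * t)) = gamma_density \<alpha> \<beta> t"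
    using eventually_gt_at_top[of 0] by eventually_elim (simp add: gamma_density_def)
qed

lemma continuous_on_gamma_density:
  assumes "1 < \<alpha>"
  shows "continuous_on UNIV (gamma_density \<alpha> \<beta>)"
proof -
  \<comment> \<open>Since \<open>0 powr a = 0\<close>, truncating the base replaces the case
    distinction; the positive exponent gives continuity at 0.\<close>
  have "gamma_density \<alpha> \<beta> = (\<lambda>x. \<beta> powr \<alpha> / Gamma \<alpha> * max 0 x powr (\<alpha> - 1) * exp (- \<beta> * x))"
    by (auto simp: gamma_density_def fun_eq_iff)
  moreover have "continuous_on UNIV (\<lambda>x::real. max 0 x powr (\<alpha> - 1))"
    using assms by (intro continuous_on_powr' continuous_intros) auto
  hence "continuous_on UNIV (\<lambda>x. \<beta> powr \<alpha> / Gamma \<alpha> * max 0 x powr (\<alpha> - 1) * exp (- \<beta> * x))"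
    by (intro continuous_on_mult continuous_on_const continuous_on_exp continuous_on_id)
  ultimately show ?thesis
    by (simp only:)
qed

lemma gamma_density_bounded_UNIV:
  assumes "1 < \<alpha>" "\<beta> > 0"
  obtains B where "\<And>t. gamma_density \<alpha> \<beta> t \<le> B"
proof -
  obtain B where B: "\<And>t. 1 \<le> t \<Longrightarrow> gamma_density \<alpha> \<beta> t \<le> B"
    using gamma_density_bounded[of \<alpha> \<beta> 1] assms by auto
  let ?C = "\<beta> powr \<alpha> / Gamma \<alpha>"
  have C: "0 \<le> ?C"
    using assms by (simp add: Gamma_real_pos less_imp_le)
  have "gamma_density \<alpha> \<beta> t \<le> max B ?C" for t
  proof (cases "0 < t \<and> t < 1")
    case True
    hence "?C * (t powr (\<alpha> - 1) * exp (- \<beta> * t)) \<le> ?C * (1 * 1)"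
      using assms C powr_mono2[of "\<alpha> - 1" t 1] by (intro mult_left_mono mult_mono) auto
    thus ?thesis
      using True by (simp add: gamma_density_def mult.assoc le_max_iff_disj)
  next
    case False
    thus ?thesis
      using B[of t] C by (cases "0 < t") (auto simp: gamma_density_def le_max_iff_disj)
  qed
  thus ?thesis
    by (rule that)
qed

section \<open>The case of a shape parameter above 1\<close>

locale bilateral_gamma =
  fixes ap lp am lm :: real
  assumes ap: "1 < ap" and lp: "0 < lp" and am: "0 < am" and lm: "0 < lm"
begin

text \<open>Unlike the explicit formula, this integral also supplies the right value at 0.\<close>

definition F :: "real \<Rightarrow> real" where
  "F x = (\<integral>y. gamma_density ap lp (x + y) * gamma_density am lm y \<partial>lborel)"

text \<open>The majorant does not depend on \<open>x\<close>, as \<open>1 < ap\<close> bounds the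
  first factor globally. Dominated convergence then gives both continuity and the limits at
  infinity.\<close>

lemma dominated:
  obtains w where "integrable lborel w"
    "\<And>x y. norm (gamma_density ap lp (x + y) * gamma_density am lm y) \<le> w y"
proof -
  obtain B where B: "\<And>t. gamma_density ap lp t \<le> B"
    using gamma_density_bounded_UNIV[OF ap lp] by blast
  show ?thesis
  proof (rule that)
    show "integrable lborel (\<lambda>y. B * gamma_density am lm y)"
      using am lm by (simp add: integrable_gamma_density)
    show "norm (gamma_density ap lp (x + y) * gamma_density am lm y) \<le> B * gamma_density am lm y" for x y
      using ap am B[of "x + y"] by (simp add: abs_mult gamma_density_nonneg mult_right_mono)
  qed
qed

lemma integrable_F: "integrable lborel (\<lambda>y. gamma_density ap lp (x + y) * gamma_density am lm y)"
proof -
  obtain w where w: "integrable lborel w"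
    "\<And>x y. norm (gamma_density ap lp (x + y) * gamma_density am lm y) \<le> w y"
    by (rule dominated) (rule that)
  show ?thesis
  proof (rule Bochner_Integration.integrable_bound[OF w(1)])
    show "AE y in lborel. norm (gamma_density ap lp (x + y) * gamma_density am lm y) \<le> norm (w y)"
      using w(2)[of x] by (intro AE_I2) (metis abs_ge_self order_trans real_norm_def)
  qed simp
qed

text \<open>Substituting \<open>y = u - t\<close> moves the shift to the other factor, so that an
  increment of \<open>F\<close> becomes one integral against a difference of shifted
  densities.\<close>

lemma F_shift:
  "integrable lborel (\<lambda>u. gamma_density ap lp (x + u) * gamma_density am lm (u - t))"
  "F (x + t) = (\<integral>u. gamma_density ap lp (x + u) * gamma_density am lm (u - t) \<partial>lborel)"
proof -
  let ?g = "\<lambda>y. gamma_density ap lp (x + t + y) * gamma_density am lm y"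
  have eq: "?g (- t + 1 * u) = gamma_density ap lp (x + u) * gamma_density am lm (u - t)" for u
    by simp
  show "integrable lborel (\<lambda>u. gamma_density ap lp (x + u) * gamma_density am lm (u - t))"
    using lborel_integrable_real_affine[OF integrable_F[of "x + t"], of 1 "- t"]
    unfolding eq by simp
  show "F (x + t) = (\<integral>u. gamma_density ap lp (x + u) * gamma_density am lm (u - t) \<partial>lborel)"
    using lborel_integral_real_affine[of 1 ?g "- t"] unfolding F_def eq by simp
qed

lemma F_diff:
  defines "D \<equiv> \<lambda>t u. gamma_density am lm (u - t) - gamma_density am lm u"
  shows "integrable lborel (\<lambda>u. gamma_density ap lp (x + u) * D t u)"
    and "F (x + t) - F x = (\<integral>u. gamma_density ap lp (x + u) * D t u \<partial>lborel)"
  using F_shift[of x t] integrable_F[of x] by (simp_all add: D_def F_def right_diff_distrib)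

text \<open>The increment is the integral of \<open>gamma_density ap lp (x + u)\<close> against a function of \<open>u\<close> with
  a single sign change, from negative to positive. By log-concavity, increasing \<open>x\<close> shifts weight
  towards the negative part.\<close>

lemma F_decreases_again:
  assumes "t > 0" and dec: "F (x + t) \<le> F x"
  shows "F (x + t + t) < F (x + t)"
proof -
  define G where "G = gamma_density ap lp"
  define D where "D u = gamma_density am lm (u - t) - gamma_density am lm u" for u
  have int: "integrable lborel (\<lambda>u. G (y + u) * D u)"
    and diff: "F (y + t) - F y = (\<integral>u. G (y + u) * D u \<partial>lborel)" for y
    using F_diff[of y t] by (simp_all add: G_def D_def)
  obtain c where neg: "\<And>u. u < c \<Longrightarrow> D u \<le> 0" and pos: "\<And>u. c < u \<Longrightarrow> 0 < D u"
    using gamma_density_shift_sign_change[OF am lm \<open>t > 0\<close>] unfolding D_def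
    by (metis diff_gt_0_iff_gt diff_le_0_iff_le)
  have G0: "G u = 0" if "u \<le> 0" for u
    using that by (simp add: G_def gamma_density_def)
  have Gpos: "G u > 0" if "u > 0" for u
    using that ap lp by (simp add: G_def gamma_density_pos)
  have Gnn: "G u \<ge> 0" for u
    using ap by (simp add: G_def gamma_density_nonneg)
  \<comment> \<open>Otherwise \<open>G (x + u)\<close> vanishes wherever \<open>D u\<close> may fail
    to be positive, and the increment would be positive.\<close>
  have "x + c > 0"
  proof (rule ccontr)
    assume c: "\<not> ?thesis"
    have "0 < (\<integral>u. G (x + u) * D u \<partial>lborel)"
    proof (rule integral_pos_ray[OF int])
      show "0 \<le> G (x + u) * D u" for u
        using c G0[of "x + u"] Gnn[of "x + u"] pos[of u] by (cases "x + u \<le> 0") auto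
      show "0 < G (x + u) * D u" if "- x < u" for u
        using c that Gpos[of "x + u"] pos[of u] by auto
    qed
    with dec diff[of x] show False
      by simp
  qed
  \<comment> \<open>The weights make the bracket in \<open>h\<close> vanish at \<open>u = c\<close>.
    By log-concavity it is nonpositive before \<open>c\<close> and positive after, matching the sign
    of \<open>D\<close>.\<close>
  let ?h = "\<lambda>u. G (x + t + c) * (G (x + u) * D u) - G (x + c) * (G (x + t + u) * D u)"
  have h: "?h u = (G (x + t + c) * G (x + u) - G (x + t + u) * G (x + c)) * D u" for u
    by (simp add: algebra_simps)
  have lc: "G (x + t + v) * G (x + u) \<le> G (x + t + u) * G (x + v)" if "u < v" for u v
    using gamma_density_log_concave(1)[OF ap lp _ \<open>t > 0\<close>, of "x + u" "x + v"] that
    by (simp add: G_def add_ac)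
  have lcs: "G (x + t + v) * G (x + u) < G (x + t + u) * G (x + v)" if "u < v" "0 < x + u" for u v
    using gamma_density_log_concave(2)[OF ap lp _ \<open>t > 0\<close>, of "x + u" "x + v"] that
    by (simp add: G_def add_ac)
  have hpos: "0 < ?h u" if "c < u" for u
    unfolding h using lcs[OF that \<open>x + c > 0\<close>] pos[OF that] by (simp add: mult_ac)
  have "0 < (\<integral>u. ?h u \<partial>lborel)"
  proof (rule integral_pos_ray[of _ c])
    show "0 \<le> ?h u" for u
    proof (cases u c rule: linorder_cases)
      case less
      thus ?thesis
        unfolding h using lc[of u c] neg[of u] by (intro mult_nonpos_nonpos) auto
    qed (use hpos[of u] in \<open>auto simp: mult_ac\<close>)
  qed (use hpos int in auto)
  also have "\<dots> = G (x + t + c) * (\<integral>u. G (x + u) * D u \<partial>lborel)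
      - G (x + c) * (\<integral>u. G (x + t + u) * D u \<partial>lborel)"
    using int by simp
  also have "\<dots> = G (x + t + c) * (F (x + t) - F x) - G (x + c) * (F (x + t + t) - F (x + t))"
    by (simp only: diff)
  finally have "G (x + c) * (F (x + t + t) - F (x + t)) < G (x + t + c) * (F (x + t) - F x)"
    by simp
  also have "\<dots> \<le> 0"
    using dec Gnn[of "x + t + c"] by (intro mult_nonneg_nonpos) auto
  finally show ?thesis
    using Gpos[OF \<open>x + c > 0\<close>] by (simp add: mult_less_0_iff)
qed

lemma continuous_on_F: "continuous_on UNIV F"
proof -
  obtain w where w: "integrable lborel w"
    "\<And>x y. norm (gamma_density ap lp (x + y) * gamma_density am lm y) \<le> w y"
    by (rule dominated) (rule that)
  have G: "isCont (gamma_density ap lp) x" for x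
    using continuous_on_gamma_density[OF ap] by (simp add: continuous_on_eq_continuous_at)
  have "(\<lambda>n. F (s n)) \<longlonglongrightarrow> F x" if "s \<longlonglongrightarrow> x" for s x
    unfolding F_def
  proof (rule integral_dominated_convergence[OF _ _ w(1)])
    show "AE y in lborel. (\<lambda>n. gamma_density ap lp (s n + y) * gamma_density am lm y)
            \<longlonglongrightarrow> gamma_density ap lp (x + y) * gamma_density am lm y"
      using that by (intro AE_I2 tendsto_intros isCont_tendsto_compose[OF G])
  qed (use w(2) in auto)
  thus ?thesis
    by (auto simp: continuous_on_eq_continuous_at continuous_at_sequentially o_def)
qed

lemma F_pos: "F x > 0"
  unfolding F_def
  \<comment> \<open>Beyond this bound both factors have positive arguments.\<close>
  by (rule integral_pos_ray[OF integrable_F, where c = "max 0 (- x)"])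
    (use ap lp am lm in \<open>auto simp: gamma_density_nonneg gamma_density_pos\<close>)

lemma F_tendsto: "(F \<longlongrightarrow> 0) at_top" "((\<lambda>x. F (- x)) \<longlongrightarrow> 0) at_top"
proof -
  obtain w where w: "integrable lborel w"
    "\<And>x y. norm (gamma_density ap lp (x + y) * gamma_density am lm y) \<le> w y"
    by (rule dominated) (rule that)
  \<comment> \<open>Taking \<open>g\<close> as the identity or the negation treats both ends: the
    first factor decays on the right and is eventually zero on the left.\<close>
  have *: "((\<lambda>x. F (g x)) \<longlongrightarrow> 0) at_top"
    if "\<And>y. ((\<lambda>x. gamma_density ap lp (g x + y)) \<longlongrightarrow> 0) at_top" for g :: "real \<Rightarrow> real"
  proof -
    have "((\<lambda>x. F (g x)) \<longlongrightarrow> (\<integral>y. 0 \<partial>(lborel :: real measure))) at_top"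
      unfolding F_def
    proof (rule integral_dominated_convergence_at_top[where w = w])
      show "AE y in lborel. ((\<lambda>x. gamma_density ap lp (g x + y) * gamma_density am lm y) \<longlongrightarrow> 0) at_top"
        by (intro AE_I2 tendsto_mult_left_zero that)
    qed (use w in auto)
    thus ?thesis
      by simp
  qed
  show "(F \<longlongrightarrow> 0) at_top"
  proof (rule *)
    show "((\<lambda>x. gamma_density ap lp (x + y)) \<longlongrightarrow> 0) at_top" for y
      by (rule filterlim_compose[OF gamma_density_tendsto_at_top[OF lp]]) real_asymp
  qed
  show "((\<lambda>x. F (- x)) \<longlongrightarrow> 0) at_top"
  proof (rule *, rule tendsto_eventually)
    fix y
    show "\<forall>\<^sub>F x in at_top. gamma_density ap lp (- x + y) = 0"
      using eventually_ge_at_top[of y] by eventually_elim (simp add: gamma_density_def)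
  qed
qed

lemma F_has_max: obtains m where "\<And>x. F x \<le> F m"
proof -
  have "\<forall>\<^sub>F x in at_top. F x < F 0" "\<forall>\<^sub>F x in at_top. F (- x) < F 0"
    using F_tendsto F_pos by (auto intro: order_tendstoD)
  hence "\<forall>\<^sub>F x in at_top. F x < F 0 \<and> F (- x) < F 0"
    by (rule eventually_conj)
  then obtain R where R: "\<And>x. R \<le> x \<Longrightarrow> F x < F 0 \<and> F (- x) < F 0"
    by (auto simp: eventually_at_top_linorder)
  \<comment> \<open>The \<open>max\<close> keeps 0 in \<open>S\<close> even for negative
    \<open>R\<close>.\<close>
  define S where "S = {- max 0 R..max 0 R}"
  have "\<exists>m\<in>S. \<forall>x\<in>S. F x \<le> F m"
    by (intro continuous_attains_sup continuous_on_subset[OF continuous_on_F]) (auto simp: S_def)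
  then obtain m where m: "m \<in> S" "\<And>x. x \<in> S \<Longrightarrow> F x \<le> F m"
    by blast
  have "F x \<le> F m" for x
  proof (cases "x \<in> S")
    case False
    hence "F x < F 0"
      using R[of x] R[of "- x"] by (auto simp: S_def)
    also have "\<dots> \<le> F m"
      by (rule m(2)) (simp add: S_def)
    finally show ?thesis
      by simp
  qed (rule m(2))
  thus ?thesis
    by (rule that)
qed

text \<open>An interior minimum \<open>m\<close> on \<open>[x, z]\<close> would satisfy \<open>F m \<le> F (m - t)\<close> and \<open>F m \<le> F (m + t)\<close>
  for small \<open>t\<close>.\<close>

lemma F_strict_quasiconcave:
  assumes "x < y" "y < z"
  shows "min (F x) (F z) < F y"
proof (rule ccontr)
  assume "\<not> ?thesis"
  hence y: "F y \<le> F x" "F y \<le> F z"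
    by auto
  have "\<exists>m\<in>{x..z}. \<forall>v\<in>{x..z}. F m \<le> F v"
    using assms by (intro continuous_attains_inf continuous_on_subset[OF continuous_on_F]) auto
  then obtain m0 where m0: "m0 \<in> {x..z}" "\<And>v. v \<in> {x..z} \<Longrightarrow> F m0 \<le> F v"
    by blast
  \<comment> \<open>If the minimum is attained at an endpoint, \<open>y\<close> attains it as well,
    so an interior minimizer exists.\<close>
  define m where "m = (if m0 = x \<or> m0 = z then y else m0)"
  have m: "x < m" "m < z"
    using m0(1) assms by (auto simp: m_def)
  have "F m \<le> F m0"
    using y by (auto simp: m_def)
  hence min: "F m \<le> F v" if "v \<in> {x..z}" for v
    using m0(2)[OF that] by simp
  define t where "t = min (m - x) (z - m)"
  have t: "t > 0" "x \<le> m - t" "m + t \<le> z"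
    using m by (auto simp: t_def)
  have "F m \<le> F (m - t)"
    using t m by (intro min) auto
  hence "F (m + t) < F m"
    using F_decreases_again[of t "m - t"] t by simp
  moreover have "F m \<le> F (m + t)"
    using t m by (intro min) auto
  ultimately show False
    by simp
qed

text \<open>With the maximizer as one outer point, the minimum in strict quasiconcavity is the value
  at the other.\<close>

lemma F_unimodal: "\<exists>m. strict_mono_on {..<m} F \<and> strict_antimono_on {m<..} F"
proof -
  obtain m where m: "\<And>x. F x \<le> F m"
    by (rule F_has_max) blast
  have "F x < F y" if "x < y" "y < m" for x y
    using F_strict_quasiconcave[OF that] m[of x] by simp
  moreover have "F y < F x" if "m < x" "x < y" for x y
    using F_strict_quasiconcave[OF that] m[of y] by simp
  ultimately show ?thesis
    by (intro exI[of _ m]) (auto simp: monotone_on_def)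
qed

text \<open>Off 0 both are the same integral; continuity of \<open>F\<close> makes
  \<open>F 0\<close> the limit of \<open>f\<close> there, which fixes \<open>f 0\<close>.\<close>

lemma is_bilateral_gamma_density_eq_F:
  assumes f: "is_bilateral_gamma_density ap lp am lm f"
  shows "f = F"
proof -
  have ne: "f x = F x" if "x \<noteq> 0" for x
    using has_bochner_integral_bilateral_gamma_density[OF _ lp am lm f that] ap
    by (simp add: F_def has_bochner_integral_iff)
  have "(F \<longlongrightarrow> F 0) (at 0)"
    using continuous_on_F by (simp add: continuous_on_def)
  hence "(f \<longlongrightarrow> F 0) (at 0)"
    by (rule Lim_transform_eventually) (auto simp: eventually_at_filter ne)
  hence "f 0 = F 0"
    using f by (simp add: is_bilateral_gamma_density_def)
  thus ?thesis
    using ne by (metis ext)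
qed

end

section \<open>Both shape parameters at most 1, and the combination of the cases\<close>

lemma bilateral_gamma_density_decreasing:
  assumes ap: "0 < ap" "ap \<le> 1" and pos: "0 < lp" "0 < am" "0 < lm"
    and f: "is_bilateral_gamma_density ap lp am lm f" and "0 < x" "x < y"
  shows "f y < f x"
proof -
  let ?g = "\<lambda>x u. gamma_density ap lp (x + u) * gamma_density am lm u"
  have I: "has_bochner_integral lborel (?g x) (f x)" "has_bochner_integral lborel (?g y) (f y)"
    using assms by (auto intro!: has_bochner_integral_bilateral_gamma_density)
  \<comment> \<open>As \<open>x\<close> is positive, \<open>x + u\<close> and \<open>y + u\<close>
    both lie where the first density decreases.\<close>
  have less: "?g y u < ?g x u" if "0 < u" for u
    using that assms by (intro mult_strict_right_mono gamma_density_decreasing gamma_density_pos) auto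
  have "0 < (\<integral>u. ?g x u - ?g y u \<partial>lborel)"
  proof (rule integral_pos_ray[of _ 0])
    show "0 \<le> ?g x u - ?g y u" for u
      using less[of u] by (cases "0 < u") (auto simp: gamma_density_def[of am])
  qed (use less I in \<open>auto simp: has_bochner_integral_iff\<close>)
  thus ?thesis
    using I by (simp add: has_bochner_integral_iff)
qed

theorem theorem5p1:
  fixes ap lp am lm :: real and f :: "real \<Rightarrow> real"
  assumes "ap > 0" and "lp > 0" and "am > 0" and "lm > 0"
    and "is_bilateral_gamma_density ap lp am lm f"
  shows "\<exists>x\<^sub>0. strict_mono_on {..<x\<^sub>0} f \<and> strict_antimono_on {x\<^sub>0<..} f"
proof -
  note refl = is_bilateral_gamma_density_reflect[OF assms(5)]
  consider "1 < ap" | "1 < am" | "ap \<le> 1" "am \<le> 1"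
    by linarith
  thus ?thesis
  proof cases
    case 1
    interpret bilateral_gamma ap lp am lm
      using 1 assms by unfold_locales
    show ?thesis
      using F_unimodal is_bilateral_gamma_density_eq_F[OF assms(5)] by simp
  next
    case 2
    interpret bilateral_gamma am lm ap lp
      using 2 assms by unfold_locales
    obtain m where m: "strict_mono_on {..<m} (\<lambda>x. f (- x))" "strict_antimono_on {m<..} (\<lambda>x. f (- x))"
      using F_unimodal is_bilateral_gamma_density_eq_F[OF refl] by auto
    have "f x < f y" if "x < y" "y < - m" for x y
      using monotone_onD[OF m(2), of "- y" "- x"] that by simp
    moreover have "f y < f x" if "x < y" "- m < x" for x y
      using monotone_onD[OF m(1), of "- y" "- x"] that by simp
    ultimately show ?thesis
      by (intro exI[of _ "- m"]) (auto simp: monotone_on_def)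
  next
    case 3
    have "f y < f x" if "0 < x" "x < y" for x y
      using bilateral_gamma_density_decreasing[OF assms(1) 3(1) assms(2-5) that] .
    \<comment> \<open>The reflected density has the parameter pairs exchanged, so the bound on
      \<open>am\<close> applies.\<close>
    moreover have "f x < f y" if "x < y" "y < 0" for x y
      using bilateral_gamma_density_decreasing[OF assms(3) 3(2) assms(4,1,2) refl, of "- y" "- x"] that
      by simp
    ultimately show ?thesis
      by (intro exI[of _ 0]) (auto simp: monotone_on_def)
  qed
qed

end
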